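(* Let $\mathcal X\subseteq\mathbb R^{d_x}$ be a Borel set and let $K$ be a Markov kernel on $\mathcal X$ given by $K(x',dx)=p(x\mid x')\,dx$ (with respect to Lebesgue measure) with $$p(x\mid x')=\phi\big(\psi(\|x-h(x')\|_{\Sigma^{-1}})\big),$$ where $\Sigma\in\mathbb R^{d_x\times d_x}$ is symmetric positive definite, $\|z\|_{\Sigma^{-1}}:=\sqrt{z^\top\Sigma^{-1}z}$, $\phi:\mathbb R\to(0,\infty)$ is non-increasing, $\psi:[0,\infty)\to\mathbb R$ is non-decreasing, and $h:\mathcal X\to\mathcal X$ is uniformly bounded, $M:=\sup_{x\in\mathcal X}\|h(x)\|<\infty$ (Euclidean norm). Let $M_\Sigma:=\sup_{x\in\mathcal X}\|h(x)\|_{\Sigma^{-1}}$. Then $\|K\|\le1-\kappa$, where $$\kappa:=\int_{\mathcal X}\phi\big(\psi(\|x\|_{\Sigma^{-1}}+M_\Sigma)\big)\,dx.$$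
   Context: For a finite signed measure $m$ on $\mathcal X$, $\|m\|_{\mathrm{TV}}:=\tfrac12\big(\sup_F m(F)-\inf_F m(F)\big)$, over Borel sets $F\subseteq\mathcal X$. The kernel acts on signed measures by $K(m)(A):=\int_{\mathcal X}K(x',A)\,m(dx')$. With $\mathcal P(\mathcal X)$ the Borel probability measures on $\mathcal X$ and $\mathcal D(\mathcal X):=\{\beta(\mu-\nu):\beta\in\mathbb R,\ \mu,\nu\in\mathcal P(\mathcal X)\}$, the operator norm is $\|K\|:=\sup_{0\ne\lambda\in\mathcal D(\mathcal X)}\|K(\lambda)\|_{\mathrm{TV}}/\|\lambda\|_{\mathrm{TV}}$. *)

theory Defs
  imports "HOL-Probability.Probability"
begin

text \<open>
  A finite signed measure on \<open>M\<close> is represented by its set function of type \<open>'a set \<Rightarrow> real\<close>.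
  As for \<^const>\<open>measure\<close>, its value off \<open>sets M\<close> is \<open>0\<close>; hence the zero signed measure
  is the constant zero function.
\<close>

definition tv_norm :: "'a measure \<Rightarrow> ('a set \<Rightarrow> real) \<Rightarrow> real" where
  "tv_norm M m = ((SUP F\<in>sets M. m F) - (INF F\<in>sets M. m F)) / 2"

text \<open>
  The positive part of the Jordan decomposition, \<open>m\<^sup>+(A) = sup {m(B). B \<subseteq> A}\<close>; the negative
  part is the positive part of \<open>- m\<close>. Since \<open>B = {}\<close> contributes \<open>0\<close>, truncating negative values
  by \<^const>\<open>ennreal\<close> does not change the supremum.
\<close>

definition pos_variation :: "'a measure \<Rightarrow> ('a set \<Rightarrow> real) \<Rightarrow> 'a measure" where
  "pos_variation M m =
     measure_of (space M) (sets M) (\<lambda>A. SUP B\<in>{B \<in> sets M. B \<subseteq> A}. ennreal (m B))"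

definition signed_integral :: "'a measure \<Rightarrow> ('a set \<Rightarrow> real) \<Rightarrow> ('a \<Rightarrow> real) \<Rightarrow> real" where
  "signed_integral M m f =
     integral\<^sup>L (pos_variation M m) f - integral\<^sup>L (pos_variation M (\<lambda>A. - m A)) f"

definition kernel_action ::
    "'a measure \<Rightarrow> ('a \<Rightarrow> 'a measure) \<Rightarrow> ('a set \<Rightarrow> real) \<Rightarrow> ('a set \<Rightarrow> real)" where
  "kernel_action M K m A = signed_integral M m (\<lambda>x'. measure (K x') A)"

definition prob_differences :: "'a measure \<Rightarrow> ('a set \<Rightarrow> real) set" where
  "prob_differences M =
     {(\<lambda>A. \<beta> * (measure \<mu> A - measure \<nu> A)) | \<beta> \<mu> \<nu>.
        \<mu> \<in> space (prob_algebra M) \<and> \<nu> \<in> space (prob_algebra M)}"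

text \<open>The supremum is taken in \<^typ>\<open>ereal\<close>, so that it is meaningful without boundedness.\<close>

definition kernel_norm :: "'a measure \<Rightarrow> ('a \<Rightarrow> 'a measure) \<Rightarrow> ereal" where
  "kernel_norm M K =
     (SUP l \<in> prob_differences M - {\<lambda>_. 0}. ereal (tv_norm M (kernel_action M K l) / tv_norm M l))"

definition sym_pos_def :: "real ^ 'n ^ 'n \<Rightarrow> bool" where
  "sym_pos_def S \<longleftrightarrow> transpose S = S \<and> (\<forall>z. z \<noteq> 0 \<longrightarrow> z \<bullet> (S *v z) > 0)"

definition weighted_norm :: "real ^ 'n ^ 'n \<Rightarrow> real ^ 'n \<Rightarrow> real" where
  "weighted_norm W z = sqrt (z \<bullet> (W *v z))"

end

theory Submission
  imports Defs
begin

text \<open>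
  This is a Doeblin minorisation argument. By the triangle inequality for the weighted norm, every
  \<open>x'\<close> satisfies \<open>\<parallel>x - h x'\<parallel> \<le> \<parallel>x\<parallel> + M\<^sub>\<Sigma>\<close>; since
  \<open>\<phi> \<circ> \<psi>\<close> is non-increasing, all the densities of the kernel lie above one
  function \<open>q x = \<phi> (\<psi> (\<parallel>x\<parallel> + M\<^sub>\<Sigma>))\<close>, whose integral over \<open>X\<close> is
  \<open>\<kappa>\<close>. Let \<open>Q\<close> be the measure on \<open>X\<close> with density \<open>q\<close>. Comparing
  \<open>K x'\<close> with \<open>Q\<close> on a set and on its complement gives
  \<open>Q A \<le> K x' A \<le> Q A + (1 - \<kappa>)\<close>, a window of width \<open>1 - \<kappa>\<close> that does not
  depend on \<open>x'\<close>.

  It remains to integrate \<open>x' \<mapsto> K x' A\<close> against a multiple \<open>l\<close> of a difference of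
  probability measures. Such an \<open>l\<close> has total mass \<open>0\<close>, hence its positive and negative
  variations have the same mass, namely the total variation norm of \<open>l\<close>
  (\<open>emeasure_pos_variation_space\<close>). The two integrals therefore lie in the same window of
  width \<open>(1 - \<kappa>) tv_norm l\<close>, and so their difference is at most that in absolute value
  (\<open>kernel_norm_le_minorization\<close>).
\<close>

section \<open>Total variation on differences of probability measures\<close>

lemma prob_differencesE:
  assumes "l \<in> prob_differences M"
  obtains c \<mu> \<nu> where "c \<ge> 0" "sets \<mu> = sets M" "sets \<nu> = sets M" "prob_space \<mu>" "prob_space \<nu>"
    "l = (\<lambda>A. c * (measure \<mu> A - measure \<nu> A))"
proof -
  obtain \<beta> \<mu> \<nu> where *: "sets \<mu> = sets M" "sets \<nu> = sets M" "prob_space \<mu>" "prob_space \<nu>"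
    and l: "l = (\<lambda>A. \<beta> * (measure \<mu> A - measure \<nu> A))"
    using assms by (auto simp: prob_differences_def space_prob_algebra)
  show thesis
  proof (cases "\<beta> \<ge> 0")
    case True
    with * l show thesis by (intro that)
  next
    case False
    have "l = (\<lambda>A. (-\<beta>) * (measure \<nu> A - measure \<mu> A))"
      unfolding l by (auto simp: algebra_simps)
    with * False show thesis by (intro that[of "-\<beta>" \<nu> \<mu>]) auto
  qed
qed

lemma uminus_prob_differences:
  assumes "l \<in> prob_differences M"
  shows "(\<lambda>A. - l A) \<in> prob_differences M"
proof -
  obtain \<beta> \<mu> \<nu> where *: "\<mu> \<in> space (prob_algebra M)" "\<nu> \<in> space (prob_algebra M)"
    and l: "l = (\<lambda>A. \<beta> * (measure \<mu> A - measure \<nu> A))"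
    using assms by (auto simp: prob_differences_def)
  have "(\<lambda>A. - l A) = (\<lambda>A. (-\<beta>) * (measure \<mu> A - measure \<nu> A))"
    unfolding l by auto
  with * show ?thesis unfolding prob_differences_def by blast
qed

lemma prob_differences_compl:
  assumes "l \<in> prob_differences M" "F \<in> sets M"
  shows "l (space M - F) = - l F"
proof -
  obtain c \<mu> \<nu> where c: "c \<ge> 0" "sets \<mu> = sets M" "sets \<nu> = sets M" "prob_space \<mu>" "prob_space \<nu>"
    "l = (\<lambda>A. c * (measure \<mu> A - measure \<nu> A))"
    using prob_differencesE[OF assms(1)] .
  have "measure \<mu> (space M - F) = 1 - measure \<mu> F" "measure \<nu> (space M - F) = 1 - measure \<nu> F"
    using prob_space.prob_compl[of \<mu> F] prob_space.prob_compl[of \<nu> F] assms(2) c(2-5)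
      sets_eq_imp_space_eq[OF c(2)] sets_eq_imp_space_eq[OF c(3)] by auto
  then show ?thesis unfolding c(6) by (simp only:) (simp add: algebra_simps)
qed

lemma bdd_above_prob_differences:
  assumes "l \<in> prob_differences M"
  shows "bdd_above (l ` sets M)"
proof -
  obtain c \<mu> \<nu> where c: "c \<ge> 0" "prob_space \<mu>" "prob_space \<nu>"
    "l = (\<lambda>A. c * (measure \<mu> A - measure \<nu> A))"
    using prob_differencesE[OF assms] by metis
  have "l F \<le> c * (1 - 0)" for F
    unfolding c(4) using c(1) prob_space.prob_le_1[OF c(2)]
    by (intro mult_left_mono diff_mono) auto
  then show ?thesis by (auto intro!: bdd_aboveI)
qed

text \<open>
  A set and its complement carry opposite values of \<open>l\<close>, so the infimum in the total variation
  norm is minus the supremum.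
\<close>

lemma tv_norm_prob_differences:
  assumes "l \<in> prob_differences M"
  shows "tv_norm M l = (SUP F\<in>sets M. l F)"
proof -
  have img: "l ` sets M = uminus ` l ` sets M"
  proof -
    have "l F \<in> uminus ` l ` sets M" if "F \<in> sets M" for F
      using prob_differences_compl[OF assms that] that
      by (intro image_eqI[of _ _ "l (space M - F)"] imageI) auto
    moreover have "- l F \<in> l ` sets M" if "F \<in> sets M" for F
      using prob_differences_compl[OF assms that] that
      by (intro image_eqI[of "- l F" l "space M - F"]) auto
    ultimately show ?thesis by auto
  qed
  have "(INF F\<in>sets M. l F) = - (SUP F\<in>sets M. l F)"
    unfolding Inf_real_def using img by simp
  then show ?thesis by (simp add: tv_norm_def)
qed

text \<open>
  On the positive set \<open>Y\<close> of a Hahn decomposition, \<open>l\<close> is a measure, and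
  \<open>A \<mapsto> l (A \<inter> Y)\<close> attains the supremum that defines the positive variation. This is
  what makes that supremum countably additive.
\<close>

lemma emeasure_pos_variation:
  assumes l: "l \<in> prob_differences M" and A: "A \<in> sets M"
  shows "emeasure (pos_variation M l) A = (SUP B\<in>{B \<in> sets M. B \<subseteq> A}. ennreal (l B))"
proof -
  obtain c \<mu> \<nu> where c: "c \<ge> 0" and [simp]: "sets \<mu> = sets M" "sets \<nu> = sets M"
    and "prob_space \<mu>" "prob_space \<nu>"
    and l_def: "l = (\<lambda>A. c * (measure \<mu> A - measure \<nu> A))"
    using prob_differencesE[OF l] .
  interpret \<mu>: prob_space \<mu> by fact
  interpret \<nu>: prob_space \<nu> by fact
  have [simp]: "space \<mu> = space M" "space \<nu> = space M"
    by (auto intro!: sets_eq_imp_space_eq)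
  obtain Y where Y[measurable]: "Y \<in> sets M"
    and pos: "\<And>B. B \<in> sets M \<Longrightarrow> B \<subseteq> Y \<Longrightarrow> emeasure \<nu> B \<le> emeasure \<mu> B"
    and neg: "\<And>B. B \<in> sets M \<Longrightarrow> B \<inter> Y = {} \<Longrightarrow> emeasure \<mu> B \<le> emeasure \<nu> B"
    using finite_unsigned_Hahn_decomposition[OF \<mu>.finite_measure_axioms \<nu>.finite_measure_axioms]
    by auto
  have l_pos: "0 \<le> l B" if "B \<in> sets M" "B \<subseteq> Y" for B
    using pos[OF that] c by (simp add: l_def \<mu>.emeasure_eq_measure \<nu>.emeasure_eq_measure)
  have l_neg: "l B \<le> 0" if "B \<in> sets M" "B \<inter> Y = {}" for B
    using neg[OF that] c
    by (auto simp: l_def \<mu>.emeasure_eq_measure \<nu>.emeasure_eq_measure intro!: mult_nonneg_nonpos)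
  have l_Un: "l (B \<union> C) = l B + l C" if "B \<in> sets M" "C \<in> sets M" "B \<inter> C = {}" for B C
    using that \<mu>.finite_measure_Union[of B C] \<nu>.finite_measure_Union[of B C]
    by (simp add: l_def algebra_simps)
  have Sup_eq: "(SUP B\<in>{B \<in> sets M. B \<subseteq> A}. ennreal (l B)) = ennreal (l (A \<inter> Y))"
    if [measurable]: "A \<in> sets M" for A
  proof (rule SUP_eqI)
    fix B assume "B \<in> {B \<in> sets M. B \<subseteq> A}"
    then have [measurable]: "B \<in> sets M" and "B \<subseteq> A" by auto
    have "l B \<le> l (B \<inter> Y)"
    proof -
      have "l (B \<inter> Y \<union> (B - Y)) = l (B \<inter> Y) + l (B - Y)"
        by (rule l_Un) auto
      moreover have "l (B - Y) \<le> 0"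
        by (rule l_neg) auto
      ultimately show ?thesis by (simp add: Int_Diff_Un)
    qed
    also have "\<dots> \<le> l (B \<inter> Y) + l ((A - B) \<inter> Y)"
      using l_pos[of "(A - B) \<inter> Y"] by simp
    also have "\<dots> = l (B \<inter> Y \<union> (A - B) \<inter> Y)"
      by (rule l_Un[symmetric]) auto
    also have "B \<inter> Y \<union> (A - B) \<inter> Y = A \<inter> Y"
      using \<open>B \<subseteq> A\<close> by auto
    finally show "ennreal (l B) \<le> ennreal (l (A \<inter> Y))" by (rule ennreal_leI)
  qed auto
  define \<mu>Y \<nu>Y where "\<mu>Y = density \<mu> (indicator Y)" and "\<nu>Y = density \<nu> (indicator Y)"
  have em: "emeasure \<mu>Y B = ennreal (measure \<mu> (B \<inter> Y))" "emeasure \<nu>Y B = ennreal (measure \<nu> (B \<inter> Y))"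
    if "B \<in> sets M" for B
    using that by (simp_all add: \<mu>Y_def \<nu>Y_def emeasure_restricted Int_commute
        \<mu>.emeasure_eq_measure \<nu>.emeasure_eq_measure)
  have [simp]: "sets \<mu>Y = sets M" "sets \<nu>Y = sets M" "space \<mu>Y = space M" "space \<nu>Y = space M"
    by (auto simp: \<mu>Y_def \<nu>Y_def)
  have fin: "finite_measure \<mu>Y" "finite_measure \<nu>Y"
    by (auto intro!: finite_measureI simp: em)
  define P where "P = scale_measure (ennreal c) (diff_measure \<mu>Y \<nu>Y)"
  have P: "emeasure P B = ennreal (l (B \<inter> Y))" if [measurable]: "B \<in> sets M" for B
  proof -
    have "emeasure (diff_measure \<mu>Y \<nu>Y) B = emeasure \<mu>Y B - emeasure \<nu>Y B"
      using fin pos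
      by (intro emeasure_diff_measure)
        (auto simp: em \<mu>.emeasure_eq_measure[symmetric] \<nu>.emeasure_eq_measure[symmetric])
    then show ?thesis
      using c by (simp add: P_def em l_def ennreal_minus ennreal_mult')
  qed
  have "sets P = sets M"
    by (simp add: P_def)
  moreover from this have "space P = space M"
    by (rule sets_eq_imp_space_eq)
  ultimately have "pos_variation M l = measure_of (space P) (sets P) (emeasure P)"
    using Sup_eq P
    by (auto simp: pos_variation_def sets.sigma_sets_eq intro!: measure_of_eq sets.space_closed)
  then have "pos_variation M l = P"
    by (simp add: measure_of_of_measure)
  with A show ?thesis by (simp add: P Sup_eq)
qed

text \<open>
  Both \<open>l\<close> and \<open>- l\<close> are differences of this kind with the same total variation
  norm, so this computes the mass of the negative variation as well, and shows that the two agree.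
\<close>

lemma emeasure_pos_variation_space:
  assumes l: "l \<in> prob_differences M"
  shows "emeasure (pos_variation M l) (space M) = ennreal (tv_norm M l)"
proof -
  have "{B \<in> sets M. B \<subseteq> space M} = sets M"
    using sets.sets_into_space by auto
  then have eq: "emeasure (pos_variation M l) (space M) = (SUP B\<in>sets M. ennreal (l B))"
    using emeasure_pos_variation[OF l] by simp
  have bdd: "bdd_above (l ` sets M)"
    by (rule bdd_above_prob_differences[OF l])
  have "(SUP B\<in>sets M. ennreal (l B)) = ennreal (SUP B\<in>sets M. l B)"
  proof (rule antisym)
    show "(SUP B\<in>sets M. ennreal (l B)) \<le> ennreal (SUP B\<in>sets M. l B)"
      using bdd by (intro SUP_least ennreal_leI cSUP_upper)
    show "ennreal (SUP B\<in>sets M. l B) \<le> (SUP B\<in>sets M. ennreal (l B))"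
    proof (cases "(SUP B\<in>sets M. ennreal (l B))")
      case (real r)
      have "l B \<le> r" if "B \<in> sets M" for B
      proof -
        have "ennreal (l B) \<le> ennreal r"
          unfolding real(2)[symmetric] using that by (rule SUP_upper)
        then show ?thesis using real(1) by simp
      qed
      then have "(SUP B\<in>sets M. l B) \<le> r"
        by (intro cSUP_least) auto
      then show ?thesis using real by (simp add: ennreal_leI)
    next
      case top
      show ?thesis unfolding top by (rule top_greatest)
    qed
  qed
  with eq show ?thesis by (simp add: tv_norm_prob_differences[OF l])
qed

lemma tv_norm_uminus_prob_differences:
  assumes l: "l \<in> prob_differences M"
  shows "tv_norm M (\<lambda>A. - l A) = tv_norm M l"
proof -
  have "(\<lambda>A. - l A) ` sets M = l ` sets M"
  proof (intro equalityI subsetI)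
    fix y assume "y \<in> (\<lambda>A. - l A) ` sets M"
    then obtain F where "F \<in> sets M" "y = - l F" by auto
    then show "y \<in> l ` sets M"
      using prob_differences_compl[OF l, of F] by (intro image_eqI[of _ _ "space M - F"]) auto
  next
    fix y assume "y \<in> l ` sets M"
    then obtain F where "F \<in> sets M" "y = l F" by auto
    then show "y \<in> (\<lambda>A. - l A) ` sets M"
      using prob_differences_compl[OF l, of F] by (intro image_eqI[of _ _ "space M - F"]) auto
  qed
  then show ?thesis by (simp add: tv_norm_def)
qed

section \<open>Contraction from a minorising measure\<close>

lemma lebesgue_integral_between:
  fixes f :: "'a \<Rightarrow> real"
  assumes "f \<in> borel_measurable N" "emeasure N (space N) = ennreal t" "t \<ge> 0"
    and "\<And>x. x \<in> space N \<Longrightarrow> a \<le> f x" "\<And>x. x \<in> space N \<Longrightarrow> f x \<le> b"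
  shows "a * t \<le> integral\<^sup>L N f" "integral\<^sup>L N f \<le> b * t"
proof -
  interpret finite_measure N using assms(2) by (intro finite_measureI) auto
  have int: "integrable N f"
    using assms(1,4,5)
    by (intro integrable_const_bound[where B="max \<bar>a\<bar> \<bar>b\<bar>"] AE_I2) (force simp: abs_le_iff)+
  have m: "measure N (space N) = t"
    using assms(2,3) by (simp add: measure_def)
  show "a * t \<le> integral\<^sup>L N f"
    using integral_mono[of N "\<lambda>_. a" f] int assms(4) by (simp add: m mult.commute)
  show "integral\<^sup>L N f \<le> b * t"
    using integral_mono[of N f "\<lambda>_. b"] int assms(5) by (simp add: m mult.commute)
qed

lemma tv_norm_le:
  assumes "\<And>A. A \<in> sets M \<Longrightarrow> \<bar>m A\<bar> \<le> r"
  shows "tv_norm M m \<le> r"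
proof -
  have "(SUP F\<in>sets M. m F) \<le> r" "- r \<le> (INF F\<in>sets M. m F)"
    using assms by (auto intro!: cSUP_least cINF_greatest simp: abs_le_iff minus_le_iff)
  then show ?thesis by (simp add: tv_norm_def)
qed

text \<open>
  Doeblin's condition: if all the measures \<open>K x\<close> share a common part \<open>Q\<close>, that part
  contributes nothing to \<open>K l\<close> because \<open>l\<close> has total mass \<open>0\<close>, and only the
  remaining mass \<open>1 - Q (space M)\<close> of each \<open>K x\<close> can transport variation.
\<close>

lemma kernel_norm_le_minorization:
  assumes K: "K \<in> M \<rightarrow>\<^sub>M prob_algebra M" and Q: "sets Q = sets M"
    and minor: "\<And>x A. x \<in> space M \<Longrightarrow> A \<in> sets M \<Longrightarrow> emeasure Q A \<le> emeasure (K x) A"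
  shows "kernel_norm M K \<le> 1 - enn2ereal (emeasure Q (space M))"
  unfolding kernel_norm_def
proof (rule SUP_least)
  fix l assume "l \<in> prob_differences M - {\<lambda>_. 0}"
  then have l: "l \<in> prob_differences M" by simp
  then obtain \<mu> where \<mu>: "prob_space \<mu>" "sets \<mu> = sets M"
    using prob_differencesE[OF l] by metis
  then obtain x0 where x0: "x0 \<in> space M"
    using prob_space.not_empty[of \<mu>] sets_eq_imp_space_eq[of \<mu> M] by auto
  have Kx: "prob_space (K x)" "sets (K x) = sets M" "space (K x) = space M" if "x \<in> space M" for x
    using measurable_space[OF K that] by (auto simp: space_prob_algebra dest: sets_eq_imp_space_eq)
  have [simp]: "space Q = space M" using Q by (rule sets_eq_imp_space_eq)
  have Q1: "emeasure Q (space M) \<le> 1"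
    using minor[OF x0, of "space M"] prob_space.emeasure_space_1[OF Kx(1)[OF x0]] Kx(3)[OF x0] by simp
  have "emeasure Q (space Q) \<noteq> \<infinity>" using Q1 by (auto simp: top_unique)
  then interpret Q: finite_measure Q by (rule finite_measureI)
  define \<kappa> where "\<kappa> = measure Q (space M)"
  have \<kappa>: "emeasure Q (space M) = ennreal \<kappa>"
    by (simp add: \<kappa>_def Q.emeasure_eq_measure)
  have \<kappa>01: "0 \<le> \<kappa>" "\<kappa> \<le> 1" using Q1 \<kappa> by (auto simp: \<kappa>_def)
  have lower: "measure Q A \<le> measure (K x) A" if "x \<in> space M" "A \<in> sets M" for x A
  proof -
    interpret Kx: prob_space "K x" using Kx that by auto
    show ?thesis using minor[OF that] by (simp add: Q.emeasure_eq_measure Kx.emeasure_eq_measure)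
  qed
  \<comment> \<open>The upper bound is the lower bound for the complement of \<open>A\<close>.\<close>
  have upper: "measure (K x) A \<le> measure Q A + (1 - \<kappa>)" if "x \<in> space M" "A \<in> sets M" for x A
    using lower[OF that(1), of "space M - A"] prob_space.prob_compl[OF Kx(1)[OF that(1)], of A]
      Q.finite_measure_compl[of A] Kx(2,3)[OF that(1)] that Q
    by (simp add: \<kappa>_def)
  define t where "t = tv_norm M l"
  have t0: "t \<ge> 0"
  proof -
    have "l {} = 0"
      using prob_differencesE[OF l] by (metis diff_self measure_empty mult_zero_right)
    then show ?thesis
      unfolding t_def tv_norm_prob_differences[OF l]
      using cSUP_upper[OF sets.empty_sets bdd_above_prob_differences[OF l]] by simp
  qed
  have "tv_norm M (kernel_action M K l) \<le> (1 - \<kappa>) * t"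
  proof (rule tv_norm_le)
    fix A assume A: "A \<in> sets M"
    have meas: "(\<lambda>x. measure (K x) A) \<in> borel_measurable M"
      using measurable_compose[OF K measurable_measure_prob_algebra[OF A]] .
    have bounds: "measure Q A * t \<le> integral\<^sup>L (pos_variation M m) (\<lambda>x. measure (K x) A)"
      "integral\<^sup>L (pos_variation M m) (\<lambda>x. measure (K x) A) \<le> (measure Q A + (1 - \<kappa>)) * t"
      if m: "m \<in> prob_differences M" "tv_norm M m = t" for m
    proof -
      have [simp]: "sets (pos_variation M m) = sets M" "space (pos_variation M m) = space M"
        by (simp_all add: pos_variation_def)
      have meas': "(\<lambda>x. measure (K x) A) \<in> borel_measurable (pos_variation M m)"
        using meas by (simp cong: measurable_cong_sets)
      note * = lebesgue_integral_between[OF meas', of t "measure Q A" "measure Q A + (1 - \<kappa>)"]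
      show "measure Q A * t \<le> integral\<^sup>L (pos_variation M m) (\<lambda>x. measure (K x) A)"
        "integral\<^sup>L (pos_variation M m) (\<lambda>x. measure (K x) A) \<le> (measure Q A + (1 - \<kappa>)) * t"
        using * emeasure_pos_variation_space[OF m(1)] m(2) t0 lower upper A by auto
    qed
    have tneg: "tv_norm M (\<lambda>A. - l A) = t"
      by (simp add: t_def tv_norm_uminus_prob_differences[OF l])
    \<comment> \<open>Both variations have mass \<open>t\<close>, so the common part \<open>measure Q A * t\<close> cancels.\<close>
    show "\<bar>kernel_action M K l A\<bar> \<le> (1 - \<kappa>) * t"
      using bounds[OF l t_def[symmetric]] bounds[OF uminus_prob_differences[OF l] tneg]
      unfolding kernel_action_def signed_integral_def by (simp add: abs_le_iff algebra_simps)
  qed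
  \<comment> \<open>If \<open>t = 0\<close>, the quotient is \<open>0\<close> by the convention for division by zero.\<close>
  then have "tv_norm M (kernel_action M K l) / t \<le> 1 - \<kappa>"
    using t0 \<kappa>01 by (cases "t = 0") (auto simp: pos_divide_le_eq)
  then have "ereal (tv_norm M (kernel_action M K l) / tv_norm M l) \<le> ereal (1 - \<kappa>)"
    by (simp add: t_def)
  also have "\<dots> = 1 - enn2ereal (emeasure Q (space M))"
    using \<kappa>01 by (simp add: \<kappa> one_ereal_def)
  finally show "ereal (tv_norm M (kernel_action M K l) / tv_norm M l)
      \<le> 1 - enn2ereal (emeasure Q (space M))" .
qed

section \<open>The weighted norm\<close>

lemma sym_pos_def_matrix_inv:
  assumes "sym_pos_def S"
  shows "sym_pos_def (matrix_inv S)"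
proof -
  let ?W = "matrix_inv S"
  have sym: "transpose S = S" and pos: "\<And>z. z \<noteq> 0 \<Longrightarrow> z \<bullet> (S *v z) > 0"
    using assms by (auto simp: sym_pos_def_def)
  have "S *v x = 0 \<longrightarrow> x = 0" for x
    using pos[of x] by (cases "x = 0") auto
  then have "invertible S"
    by (auto simp: invertible_left_inverse matrix_left_invertible_ker)
  then have inv: "S ** ?W = mat 1" "?W ** S = mat 1"
    by (auto simp: matrix_inv_def invertible_def intro: someI2_ex)
  have "transpose ?W ** S = mat 1"
    using arg_cong[OF inv(1), of transpose] sym by (simp add: matrix_transpose_mul transpose_mat)
  then have "transpose ?W = ?W"
    by (metis inv(1) matrix_mul_assoc matrix_mul_lid matrix_mul_rid)
  moreover have "z \<bullet> (?W *v z) > 0" if "z \<noteq> 0" for z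
  proof -
    have z: "S *v (?W *v z) = z"
      by (simp add: matrix_vector_mul_assoc inv)
    with that have "?W *v z \<noteq> 0" by auto
    \<comment> \<open>With \<open>u = S\<inverse> z\<close>, the form of the inverse at \<open>z\<close> is the form of \<open>S\<close> at \<open>u\<close>.\<close>
    from pos[OF this] show ?thesis by (simp add: z inner_commute)
  qed
  ultimately show ?thesis by (auto simp: sym_pos_def_def)
qed

lemma sym_pos_def_nonneg: "sym_pos_def W \<Longrightarrow> 0 \<le> z \<bullet> (W *v z)"
  by (cases "z = 0") (auto simp: sym_pos_def_def intro: less_imp_le)

lemma sym_pos_def_commute: "sym_pos_def W \<Longrightarrow> x \<bullet> (W *v y) = y \<bullet> (W *v x)"
  by (metis dot_lmul_matrix inner_commute sym_pos_def_def transpose_matrix_vector)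

lemma weighted_norm_nonneg: "sym_pos_def W \<Longrightarrow> 0 \<le> weighted_norm W z"
  by (simp add: weighted_norm_def sym_pos_def_nonneg)

lemma weighted_norm_minus: "weighted_norm W (- z) = weighted_norm W z"
  using matrix_vector_mult_scaleR[of W "-1" z] by (simp add: weighted_norm_def)

lemma weighted_norm_Cauchy_Schwarz:
  assumes W: "sym_pos_def W"
  shows "x \<bullet> (W *v y) \<le> weighted_norm W x * weighted_norm W y"
proof (cases "y = 0")
  case True
  then show ?thesis by (simp add: weighted_norm_def)
next
  case False
  define a b c where "a = x \<bullet> (W *v x)" and "b = x \<bullet> (W *v y)" and "c = y \<bullet> (W *v y)"
  have c: "c > 0" using W False by (simp add: c_def sym_pos_def_def)
  have yx: "y \<bullet> (W *v x) = b" unfolding b_def by (rule sym_pos_def_commute[OF W])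
  \<comment> \<open>\<open>c x - b y\<close> is \<open>c\<close> times the component of \<open>x\<close> orthogonal to \<open>y\<close>.\<close>
  have "0 \<le> (c *\<^sub>R x - b *\<^sub>R y) \<bullet> (W *v (c *\<^sub>R x - b *\<^sub>R y))"
    by (rule sym_pos_def_nonneg[OF W])
  also have "\<dots> = c * (c * a - b * b)"
    by (simp add: matrix_vector_mult_diff_distrib matrix_vector_mult_scaleR inner_diff_left
        inner_diff_right yx a_def[symmetric] b_def[symmetric] c_def[symmetric] algebra_simps)
  finally have "b\<^sup>2 \<le> a * c"
    using c by (simp add: zero_le_mult_iff power2_eq_square mult.commute)
  then have "b \<le> sqrt (a * c)" by (rule real_le_rsqrt)
  then show ?thesis
    by (simp add: weighted_norm_def real_sqrt_mult a_def b_def c_def)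
qed

lemma weighted_norm_triangle:
  assumes W: "sym_pos_def W"
  shows "weighted_norm W (x + y) \<le> weighted_norm W x + weighted_norm W y"
proof -
  have sq: "(weighted_norm W z)\<^sup>2 = z \<bullet> (W *v z)" for z
    by (simp add: weighted_norm_def sym_pos_def_nonneg[OF W])
  have "(weighted_norm W (x + y))\<^sup>2
      = (weighted_norm W x)\<^sup>2 + 2 * (x \<bullet> (W *v y)) + (weighted_norm W y)\<^sup>2"
    unfolding sq using sym_pos_def_commute[OF W, of y x]
    by (simp add: matrix_vector_right_distrib inner_add_left inner_add_right)
  also have "\<dots> \<le> (weighted_norm W x + weighted_norm W y)\<^sup>2"
    using weighted_norm_Cauchy_Schwarz[OF W, of x y] by (simp add: power2_sum)
  finally show ?thesis
    by (rule power2_le_imp_le) (simp add: weighted_norm_nonneg[OF W])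
qed

lemma continuous_on_weighted_norm: "continuous_on S (weighted_norm W)"
  unfolding weighted_norm_def
  by (intro continuous_intros linear_continuous_on_compose[of _ _ "\<lambda>z. W *v z"]
      matrix_vector_mul_linear)

lemma bdd_above_weighted_norm:
  assumes "bdd_above ((\<lambda>x. norm (h x)) ` X)"
  shows "bdd_above ((\<lambda>x. weighted_norm W (h x)) ` X)"
proof -
  obtain r where r: "\<And>x. x \<in> X \<Longrightarrow> norm (h x) \<le> r"
    using assms by (auto simp: bdd_above_def)
  have "bdd_above (weighted_norm W ` cball 0 r)"
    by (intro bounded_imp_bdd_above compact_imp_bounded compact_continuous_image
        continuous_on_weighted_norm compact_cball)
  then show ?thesis
    by (rule bdd_above_mono) (auto simp: r)
qed

section \<open>The contraction bound\<close>

lemma borel_measurable_antimono_comp_mono_on: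
  fixes \<phi> \<psi> :: "real \<Rightarrow> real"
  assumes "antimono \<phi>" "mono_on {0..} \<psi>" "g \<in> borel_measurable N" "\<And>x. 0 \<le> g x"
  shows "(\<lambda>x. \<phi> (\<psi> (g x))) \<in> borel_measurable N"
proof -
  \<comment> \<open>Precomposing with \<open>max 0\<close> extends the monotonicity of \<open>\<psi>\<close> to the whole line.\<close>
  have "mono (\<lambda>t. - \<phi> (\<psi> (max 0 t)))"
    using assms(1,2) by (intro monoI) (auto intro!: antimonoD[of \<phi>] mono_onD[of "{0..}" \<psi>])
  then have "(\<lambda>t. - \<phi> (\<psi> (max 0 t))) \<in> borel_measurable borel"
    by (rule borel_measurable_mono)
  then have "(\<lambda>t. \<phi> (\<psi> (max 0 t))) \<in> borel_measurable borel"
    using borel_measurable_uminus_eq by blast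
  from measurable_compose[OF assms(3) this] show ?thesis
    using assms(4) by (simp add: max_absorb2)
qed

theorem theorem5p2:
  fixes X :: "(real ^ 'd) set"
    and K :: "real ^ 'd \<Rightarrow> (real ^ 'd) measure"
    and \<Sigma> :: "real ^ 'd ^ 'd"
    and \<phi> \<psi> :: "real \<Rightarrow> real"
    and h :: "real ^ 'd \<Rightarrow> real ^ 'd"
  assumes "X \<in> sets borel"
    and "K \<in> restrict_space borel X \<rightarrow>\<^sub>M prob_algebra (restrict_space borel X)"
    and "\<And>x'. x' \<in> X \<Longrightarrow>
           K x' = density (restrict_space lborel X)
                    (\<lambda>x. ennreal (\<phi> (\<psi> (weighted_norm (matrix_inv \<Sigma>) (x - h x')))))"
    and "sym_pos_def \<Sigma>"
    and "\<And>t. \<phi> t > 0" and "antimono \<phi>"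
    and "mono_on {0..} \<psi>"
    and "h ` X \<subseteq> X"
    and "bdd_above ((\<lambda>x. norm (h x)) ` X)"
  shows "kernel_norm (restrict_space borel X) K
           \<le> 1 - enn2ereal (\<integral>\<^sup>+x\<in>X. ennreal (\<phi> (\<psi> (weighted_norm (matrix_inv \<Sigma>) x
                 + (SUP y\<in>X. weighted_norm (matrix_inv \<Sigma>) (h y))))) \<partial>lborel)"
proof (cases "X = {}")
  case True
  \<comment> \<open>There are no probability measures on the empty space, so the supremum is \<open>-\<infinity>\<close>.\<close>
  have "space (prob_algebra (restrict_space borel X)) = {}"
    using True by (auto simp: space_prob_algebra space_restrict_space
        dest!: sets_eq_imp_space_eq prob_space.not_empty)
  then show ?thesis
    by (simp add: kernel_norm_def prob_differences_def bot_ereal_def)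
next
  case False
  define w where "w = weighted_norm (matrix_inv \<Sigma>)"
  define m where "m = (SUP y\<in>X. w (h y))"
  let ?M = "restrict_space borel X" and ?L = "restrict_space lborel X"
  have X[measurable]: "X \<in> sets borel" by fact
  have W: "sym_pos_def (matrix_inv \<Sigma>)"
    by (rule sym_pos_def_matrix_inv) fact
  have w0: "0 \<le> w z" for z
    unfolding w_def by (rule weighted_norm_nonneg[OF W])
  have wh: "w (h y) \<le> m" if "y \<in> X" for y
    unfolding m_def w_def using that assms(9) by (intro cSUP_upper bdd_above_weighted_norm)
  have m0: "0 \<le> m"
    using False wh w0 by (meson all_not_in_conv order_trans)
  have [measurable]: "w \<in> borel_measurable borel"
    unfolding w_def by (intro borel_measurable_continuous_onI continuous_on_weighted_norm)
  define p where "p = (\<lambda>x' x. \<phi> (\<psi> (w (x - h x'))))"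
  define q where "q = (\<lambda>x. \<phi> (\<psi> (w x + m)))"
  have p_meas[measurable]: "p x' \<in> borel_measurable borel" for x'
    unfolding p_def using w0
    by (intro borel_measurable_antimono_comp_mono_on[OF assms(6,7)]) measurable
  have q_meas[measurable]: "q \<in> borel_measurable borel"
    unfolding q_def using w0 m0
    by (intro borel_measurable_antimono_comp_mono_on[OF assms(6,7)]) auto
  have q_le: "q x \<le> p x' x" if "x' \<in> X" for x' x
  proof -
    have "w (x - h x') \<le> w x + w (h x')"
      using weighted_norm_triangle[OF W, of x "- h x'"] by (simp add: w_def weighted_norm_minus)
    also have "\<dots> \<le> w x + m" using wh[OF that] by simp
    finally have "\<psi> (w (x - h x')) \<le> \<psi> (w x + m)"
      using w0 m0 by (intro mono_onD[OF assms(7)]) auto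
    then show ?thesis unfolding p_def q_def by (rule antimonoD[OF assms(6)])
  qed
  define Q where "Q = density ?L (\<lambda>x. ennreal (q x))"
  have sets_L: "sets ?L = sets ?M"
    by (simp add: sets_restrict_space)
  have meas_L: "f \<in> borel_measurable borel \<Longrightarrow> f \<in> borel_measurable ?L" for f :: "real ^ 'd \<Rightarrow> real"
    by (intro measurable_restrict_space1) simp
  have "kernel_norm ?M K \<le> 1 - enn2ereal (emeasure Q (space ?M))"
  proof (rule kernel_norm_le_minorization[OF assms(2)])
    show "sets Q = sets ?M" by (simp add: Q_def sets_L)
  next
    fix x' A assume "x' \<in> space ?M" and A: "A \<in> sets ?M"
    then have x': "x' \<in> X" by (simp add: space_restrict_space)
    have Kx: "K x' = density ?L (\<lambda>x. ennreal (p x' x))"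
      using assms(3)[OF x'] by (simp add: p_def w_def)
    show "emeasure Q A \<le> emeasure (K x') A"
      unfolding Q_def Kx using A meas_L[OF p_meas] meas_L[OF q_meas]
      by (auto simp: emeasure_density sets_L intro!: nn_integral_mono mult_right_mono ennreal_leI q_le[OF x'])
  qed
  also have "emeasure Q (space ?M) = (\<integral>\<^sup>+x\<in>X. ennreal (q x) \<partial>lborel)"
  proof -
    have sp: "space ?M = space ?L" by (simp add: space_restrict_space)
    have "emeasure Q (space ?M) = (\<integral>\<^sup>+x. ennreal (q x) * indicator (space ?L) x \<partial>?L)"
      unfolding Q_def sp using meas_L[OF q_meas] by (intro emeasure_density sets.top) auto
    also have "\<dots> = (\<integral>\<^sup>+x. ennreal (q x) \<partial>?L)"
      by (intro nn_integral_cong) simp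
    also have "\<dots> = (\<integral>\<^sup>+x\<in>X. ennreal (q x) \<partial>lborel)"
      by (intro nn_integral_restrict_space) simp
    finally show ?thesis .
  qed
  finally show ?thesis unfolding q_def m_def w_def .
qed

end
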